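(* Let $X$ be a quasi-regular space, $\mathfrak Q$ a normal square functor, $n\in\omega$, and let $\widetilde\Delta\in\{\Delta^n,\ {}^v\Delta,\ {}^c\Delta,\ {}^c\Delta^+,\ {}^c\Delta^n\}$. (1) If $X$ is $\widetilde\Delta(\mathfrak Q)$-nonmeager, then $X$ is nonmeager. (2) If $X$ is $\widetilde\Delta(\mathfrak Q)$-Baire, then $X$ is Baire.
   Context: A space $X$ is quasi-regular if for every nonempty open $U$ there is a nonempty open $V$ with $\overline V\subset U$. $X$ is nonmeager if it is not a countable union of nowhere dense subsets of itself; Baire if countable intersections of dense open sets are dense. For $P,Q\subset X\times X$: $P(x)=\{y:(x,y)\in P\}$, $P|_M=P\cap(M\times M)$, and $P\circ Q=\{(x,y):\exists z\in X,\ (x,z)\in P,\ (z,y)\in Q\}$. $\overline P$ is the closure in $X\times X$, and $\overline P^{\,v}=\bigcup_{x\in X}\{x\}\times\overline{P(x)}$. $P$ is a semi-neighborhood of the diagonal if $x\in\operatorname{Int}P(x)$ for all $x$; $\mathfrak S(X)$ is the family of all of these. A normal square functor $\mathfrak Q$ assigns to each space $X$ a family $\mathfrak Q(X)$ of nonempty subsets of $X\times X$ so that: (Q1) $\mathfrak Q(Y)=\{(f\times f)(P):P\in\mathfrak Q(X)\}$ for every homeomorphism $f:X\to Y$; (Q2) $\mathfrak Q(U)=\{P|_U:P\in\mathfrak Q(X)\}$ for nonempty open $U\subset X$; (Q3) if $S\in\mathfrak Q(X)$ and $S\subset Q\subset X\times X$ then $Q\in\mathfrak Q(X)$; (Q4)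 every $S\in\mathfrak Q(X)$ is dense in $X\times X$. For a family $\mathcal P$ of subsets of $X\times X$, $X$ is $\Delta(\mathcal P;\mathfrak Q)$-nonmeager if for each $P\in\mathcal P$ there is a nonempty open $V\subset X$ with $P|_V\in\mathfrak Q(V)$; $X$ is $\Delta(\mathcal P;\mathfrak Q)$-Baire if for each $P\in\mathcal P$ and nonempty open $U\subset X$ there is a nonempty open $V\subset U$ with $P|_V\in\mathfrak Q(V)$. For $P_0,P_1,\dots\in\mathfrak S(X)$ define $p_0=p^c_0=\emptyset$, $p_1=P_0$, $p^c_1=\overline{P_0}$, and for $m\ge1$: $p_{m+1}=p_m\circ P_m$, $p^c_{m+1}=\overline{p^c_m\circ P_m}$. Let $\mathsf P_n$ (respectively $\mathsf P^c_n$) be the family of all sets $p_n$ (respectively $p^c_n$) obtained from sequences $(P_m)_{m<n}$ in $\mathfrak S(X)$. "$X$ is $\widetilde\Delta(\mathfrak Q)$-nonmeager (-Baire)" means that $X$ is $\Delta(\mathcal P;\mathfrak Q)$-nonmeager (-Baire), where $\mathcal P$ is: $\mathsf P_n$ for $\Delta^n$; $\{\overline P^{\,v}:P\in\mathfrak S(X)\}$ for ${}^v\Delta$; $\{\overline P:P\in\mathfrak S(X)\}$ for ${}^c\Delta$; $\{\overline{Q\circ P}^{\,v}:P,Q\in\mathfrak S(X)\}$ for ${}^c\Delta^+$; $\mathsf P^c_n$ for ${}^c\Delta^n$. *)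

theory Defs
  imports "HOL-Analysis.Analysis"
begin

definition quasi_regular_space :: "'a topology \<Rightarrow> bool" where
  "quasi_regular_space X \<longleftrightarrow>
    (\<forall>U. openin X U \<and> U \<noteq> {} \<longrightarrow> (\<exists>V. openin X V \<and> V \<noteq> {} \<and> X closure_of V \<subseteq> U))"

definition nowhere_dense_in :: "'a topology \<Rightarrow> 'a set \<Rightarrow> bool" where
  "nowhere_dense_in X N \<longleftrightarrow> N \<subseteq> topspace X \<and> X interior_of (X closure_of N) = {}"

definition nonmeager_space :: "'a topology \<Rightarrow> bool" where
  "nonmeager_space X \<longleftrightarrow>
    \<not> (\<exists>\<N>. countable \<N> \<and> (\<forall>N\<in>\<N>. nowhere_dense_in X N) \<and> topspace X = \<Union>\<N>)"

definition Baire_space :: "'a topology \<Rightarrow> bool" where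
  "Baire_space X \<longleftrightarrow>
    (\<forall>\<G>. countable \<G> \<and> (\<forall>G\<in>\<G>. openin X G \<and> X closure_of G = topspace X)
       \<longrightarrow> X closure_of (topspace X \<inter> \<Inter>\<G>) = topspace X)"

text \<open>The section \<open>P(x)\<close> is the relational image \<open>P `` {x}\<close>. The composition
  \<open>{(x,y). \<exists>z. (x,z) \<in> P \<and> (z,y) \<in> Q}\<close> is \<open>P O Q\<close>, with the factors in the same order.\<close>

definition square_restrict :: "('a \<times> 'a) set \<Rightarrow> 'a set \<Rightarrow> ('a \<times> 'a) set" where
  "square_restrict P M = P \<inter> (M \<times> M)"

definition square_closure :: "'a topology \<Rightarrow> ('a \<times> 'a) set \<Rightarrow> ('a \<times> 'a) set" where
  "square_closure X P = prod_topology X X closure_of P"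

definition vertical_closure :: "'a topology \<Rightarrow> ('a \<times> 'a) set \<Rightarrow> ('a \<times> 'a) set" where
  "vertical_closure X P = (\<Union>x\<in>topspace X. {x} \<times> (X closure_of (P `` {x})))"

definition semi_nbhds :: "'a topology \<Rightarrow> ('a \<times> 'a) set set" where
  "semi_nbhds X = {P. P \<subseteq> topspace X \<times> topspace X \<and>
     (\<forall>x\<in>topspace X. x \<in> X interior_of (P `` {x}))}"

text \<open>A square functor is represented by its values on the spaces whose points are taken from one
  arbitrary type \<open>'a\<close>. A functor defined on all spaces restricts to one of these.\<close>

definition normal_square_functor :: "('a topology \<Rightarrow> ('a \<times> 'a) set set) \<Rightarrow> bool" where
  "normal_square_functor \<Q> \<longleftrightarrow>
    (\<forall>X. \<forall>S\<in>\<Q> X. S \<noteq> {} \<and> S \<subseteq> topspace X \<times> topspace X) \<and>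
    (\<forall>X Y f. homeomorphic_map X Y f \<longrightarrow> \<Q> Y = {map_prod f f ` P | P. P \<in> \<Q> X}) \<and>
    (\<forall>X U. openin X U \<and> U \<noteq> {} \<longrightarrow>
       \<Q> (subtopology X U) = {square_restrict P U | P. P \<in> \<Q> X}) \<and>
    (\<forall>X S Q. S \<in> \<Q> X \<and> S \<subseteq> Q \<and> Q \<subseteq> topspace X \<times> topspace X \<longrightarrow> Q \<in> \<Q> X) \<and>
    (\<forall>X. \<forall>S\<in>\<Q> X. prod_topology X X closure_of S = topspace X \<times> topspace X)"

definition Delta_nonmeager ::
  "'a topology \<Rightarrow> ('a \<times> 'a) set set \<Rightarrow> ('a topology \<Rightarrow> ('a \<times> 'a) set set) \<Rightarrow> bool" where
  "Delta_nonmeager X \<P> \<Q> \<longleftrightarrow>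
    (\<forall>P\<in>\<P>. \<exists>V. openin X V \<and> V \<noteq> {} \<and> square_restrict P V \<in> \<Q> (subtopology X V))"

definition Delta_Baire ::
  "'a topology \<Rightarrow> ('a \<times> 'a) set set \<Rightarrow> ('a topology \<Rightarrow> ('a \<times> 'a) set set) \<Rightarrow> bool" where
  "Delta_Baire X \<P> \<Q> \<longleftrightarrow>
    (\<forall>P\<in>\<P>. \<forall>U. openin X U \<and> U \<noteq> {} \<longrightarrow>
       (\<exists>V. openin X V \<and> V \<noteq> {} \<and> V \<subseteq> U \<and> square_restrict P V \<in> \<Q> (subtopology X V)))"

fun comp_seq :: "(nat \<Rightarrow> ('a \<times> 'a) set) \<Rightarrow> nat \<Rightarrow> ('a \<times> 'a) set" where
  "comp_seq P 0 = {}"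
| "comp_seq P (Suc 0) = P 0"
| "comp_seq P (Suc (Suc m)) = comp_seq P (Suc m) O P (Suc m)"

fun closed_comp_seq :: "'a topology \<Rightarrow> (nat \<Rightarrow> ('a \<times> 'a) set) \<Rightarrow> nat \<Rightarrow> ('a \<times> 'a) set" where
  "closed_comp_seq X P 0 = {}"
| "closed_comp_seq X P (Suc 0) = square_closure X (P 0)"
| "closed_comp_seq X P (Suc (Suc m)) =
     square_closure X (closed_comp_seq X P (Suc m) O P (Suc m))"

text \<open>The families defining \<open>\<Delta>\<^sup>n\<close>, \<open>\<^sup>v\<Delta>\<close>, \<open>\<^sup>c\<Delta>\<close>, \<open>\<^sup>c\<Delta>\<^sup>+\<close> and \<open>\<^sup>c\<Delta>\<^sup>n\<close>, in this order.\<close>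

definition Delta_n_family :: "nat \<Rightarrow> 'a topology \<Rightarrow> ('a \<times> 'a) set set" where
  "Delta_n_family n X = {comp_seq P n | P. \<forall>m<n. P m \<in> semi_nbhds X}"

definition vDelta_family :: "'a topology \<Rightarrow> ('a \<times> 'a) set set" where
  "vDelta_family X = {vertical_closure X P | P. P \<in> semi_nbhds X}"

definition cDelta_family :: "'a topology \<Rightarrow> ('a \<times> 'a) set set" where
  "cDelta_family X = {square_closure X P | P. P \<in> semi_nbhds X}"

definition cDelta_plus_family :: "'a topology \<Rightarrow> ('a \<times> 'a) set set" where
  "cDelta_plus_family X =
     {vertical_closure X (Q O P) | P Q. P \<in> semi_nbhds X \<and> Q \<in> semi_nbhds X}"

definition cDelta_n_family :: "nat \<Rightarrow> 'a topology \<Rightarrow> ('a \<times> 'a) set set" where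
  "cDelta_n_family n X = {closed_comp_seq X P n | P. \<forall>m<n. P m \<in> semi_nbhds X}"

end

theory Submission
  imports Defs
begin

text \<open>
  Both parts follow from one construction. Let \<open>U\<^sub>0\<close> be an open set in which the space fails to be
  Baire: there are dense open sets \<open>G\<^sub>0, G\<^sub>1, \<dots>\<close> with no common point in \<open>U\<^sub>0\<close>. If \<open>X\<close> is
  meager, \<open>U\<^sub>0 = X\<close> is such a set. Starting from \<open>\<gamma>\<^sub>0 = {U\<^sub>0}\<close>, quasi-regularity and Zorn's lemma give disjoint families \<open>\<gamma>\<^sub>m\<close> of open sets with
  union dense in \<open>U\<^sub>0\<close>, such that the closure of each member of \<open>\<gamma>\<^sub>m\<^sub>+\<^sub>1\<close> lies in \<open>G\<^sub>m\<close> and in a member of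
  \<open>\<gamma>\<^sub>m\<close> (\<open>nested_families_exist\<close>). No point of \<open>U\<^sub>0\<close> survives through all levels, so it lies in only
  finitely many members, and

    \<open>P(x) =\<close> the intersection of \<open>X\<close> with all members of \<open>\<Union>\<^sub>m \<gamma>\<^sub>m\<close> containing \<open>x\<close>

  is an open neighbourhood of \<open>x\<close>.

  The relation \<open>P\<close> maps each member into itself. A closure enlarges the image of a member only up to
  the member of the preceding level that contains its closure. Hence every relation built from \<open>P\<close>
  by finitely many compositions and closures maps a member of level \<open>m + k\<close> into the member of level
  \<open>m\<close> above it, for a fixed \<open>k\<close>; such a relation has \<open>lag k\<close>.

  The closures being inside \<open>G\<^sub>m\<close> has a second effect: every nonempty open \<open>V \<subseteq> U\<^sub>0\<close> meets two distinct
  members \<open>A\<close>, \<open>B\<close> of a common level (\<open>splits\<close>). If \<open>V\<close> met only \<open>A\<close> at level \<open>m + 1\<close>, then \<open>V\<close> would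
  lie in the closure of \<open>A\<close> and hence in \<open>G\<^sub>m\<close>, and this cannot happen for all \<open>m\<close>. A relation with
  lag \<open>k\<close> maps a member \<open>W \<subseteq> A\<close>, chosen \<open>k\<close> levels below \<open>A\<close>, into \<open>A\<close>, so it misses the box
  \<open>W \<times> B\<close> and is not dense in \<open>V \<times> V\<close>. By the density axiom for normal square functors this refutes
  the \<open>\<Delta>\<close>-property in question.
\<close>

section \<open>Nested disjoint families of open sets\<close>

locale nested_families =
  fixes X :: "'a topology" and U\<^sub>0 :: "'a set" and G :: "nat \<Rightarrow> 'a set"
    and \<gamma> :: "nat \<Rightarrow> 'a set set"
  assumes root: "\<gamma> 0 = {U\<^sub>0}"
    and open_member: "U \<in> \<gamma> m \<Longrightarrow> openin X U"
    and disjoint_members: "U \<in> \<gamma> m \<Longrightarrow> U' \<in> \<gamma> m \<Longrightarrow> U \<inter> U' \<noteq> {} \<Longrightarrow> U = U'"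
    and shrinks: "W \<in> \<gamma> (Suc m) \<Longrightarrow> \<exists>U\<in>\<gamma> m. X closure_of W \<subseteq> U \<inter> G m"
    and dense_union: "openin X V \<Longrightarrow> V \<noteq> {} \<Longrightarrow> V \<subseteq> U\<^sub>0 \<Longrightarrow> \<exists>U\<in>\<gamma> m. U \<inter> V \<noteq> {}"
    and no_common_point: "x \<in> U\<^sub>0 \<Longrightarrow> \<exists>m. x \<notin> G m"

lemma maximal_disjoint_subfamily:
  obtains \<F> where "\<F> \<subseteq> \<B>" "pairwise disjnt \<F>"
    "\<And>B. B \<in> \<B> \<Longrightarrow> B \<noteq> {} \<Longrightarrow> \<exists>F\<in>\<F>. F \<inter> B \<noteq> {}"
proof -
  define \<A> where "\<A> = {\<F>. \<F> \<subseteq> \<B> \<and> pairwise disjnt \<F>}"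
  have "\<exists>M\<in>\<A>. \<forall>Y\<in>\<A>. M \<subseteq> Y \<longrightarrow> Y = M"
  proof (rule subset_Zorn')
    fix C assume "subset.chain \<A> C"
    then have sub: "C \<subseteq> \<A>" and lin: "\<And>S T. S \<in> C \<Longrightarrow> T \<in> C \<Longrightarrow> S \<subseteq> T \<or> T \<subseteq> S"
      by (auto simp: subset_chain_def)
    have "pairwise disjnt (\<Union>C)"
    proof (rule pairwiseI)
      fix S T assume "S \<in> \<Union>C" "T \<in> \<Union>C" "S \<noteq> T"
      then obtain D where "D \<in> C" "S \<in> D" "T \<in> D"
        using lin by blast
      moreover have "pairwise disjnt D"
        using sub \<open>D \<in> C\<close> by (auto simp: \<A>_def)
      ultimately show "disjnt S T"
        using \<open>S \<noteq> T\<close> by (simp add: pairwiseD)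
    qed
    with sub show "\<Union>C \<in> \<A>"
      by (auto simp: \<A>_def)
  qed
  then obtain M where M: "M \<in> \<A>" and max: "\<And>Y. Y \<in> \<A> \<Longrightarrow> M \<subseteq> Y \<Longrightarrow> Y = M"
    by blast
  show thesis
  proof
    show "M \<subseteq> \<B>" "pairwise disjnt M"
      using M by (auto simp: \<A>_def)
    fix B assume B: "B \<in> \<B>" "B \<noteq> {}"
    show "\<exists>F\<in>M. F \<inter> B \<noteq> {}"
    proof (rule ccontr)
      assume none: "\<not> ?thesis"
      then have "insert B M \<in> \<A>"
        using M B by (auto simp: \<A>_def pairwise_insert disjnt_def)
      then have "B \<in> M"
        using max by blast
      with none B show False by blast
    qed
  qed
qed

text \<open>A maximal disjoint family of admissible sets \<open>W\<close> does it: if \<open>U \<in> \<U>\<close> meets \<open>V\<close>, then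
  quasi-regularity, applied to \<open>G \<inter> U \<inter> V\<close>, puts a nonempty admissible set inside \<open>V\<close>, and by
  maximality this set meets a member of the family.\<close>

lemma quasi_regular_open_disjoint_refinement:
  assumes qr: "quasi_regular_space X"
    and \<U>: "\<And>U. U \<in> \<U> \<Longrightarrow> openin X U"
    and G: "openin X G" "X closure_of G = topspace X"
  obtains \<F> where "\<And>W. W \<in> \<F> \<Longrightarrow> openin X W" "pairwise disjnt \<F>"
    "\<And>W. W \<in> \<F> \<Longrightarrow> \<exists>U\<in>\<U>. X closure_of W \<subseteq> U \<inter> G"
    "\<And>V. openin X V \<Longrightarrow> \<exists>U\<in>\<U>. U \<inter> V \<noteq> {} \<Longrightarrow> \<exists>W\<in>\<F>. W \<inter> V \<noteq> {}"
proof -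
  define \<B> where "\<B> = {W. openin X W \<and> (\<exists>U\<in>\<U>. X closure_of W \<subseteq> U \<inter> G)}"
  obtain \<F> where \<F>: "\<F> \<subseteq> \<B>" "pairwise disjnt \<F>"
    and max: "\<And>B. B \<in> \<B> \<Longrightarrow> B \<noteq> {} \<Longrightarrow> \<exists>F\<in>\<F>. F \<inter> B \<noteq> {}"
    using maximal_disjoint_subfamily by blast
  show thesis
  proof
    fix V assume V: "openin X V" "\<exists>U\<in>\<U>. U \<inter> V \<noteq> {}"
    then obtain U where U: "U \<in> \<U>" "U \<inter> V \<noteq> {}" by blast
    have op: "openin X (U \<inter> V)"
      using U V \<U> by blast
    then have "G \<inter> (U \<inter> V) \<noteq> {}"
      using G(2) U(2) openin_subset[OF op]
      by (metis dense_intersects_open)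
    moreover have "openin X (G \<inter> (U \<inter> V))"
      using G op by blast
    ultimately obtain W where W: "openin X W" "W \<noteq> {}" "X closure_of W \<subseteq> G \<inter> (U \<inter> V)"
      using qr unfolding quasi_regular_space_def by blast
    then have "W \<in> \<B>"
      using U(1) unfolding \<B>_def by blast
    then obtain F where "F \<in> \<F>" "F \<inter> W \<noteq> {}"
      using max W(2) by blast
    moreover have "W \<subseteq> V"
      using W closure_of_subset[of W X] openin_subset[of X W] by blast
    ultimately show "\<exists>W\<in>\<F>. W \<inter> V \<noteq> {}" by blast
  qed (use \<F> in \<open>auto simp: \<B>_def\<close>)
qed

lemma nested_families_exist:
  assumes qr: "quasi_regular_space X"
    and U\<^sub>0: "openin X U\<^sub>0"
    and G: "\<And>m. openin X (G m)" "\<And>m. X closure_of G m = topspace X"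
    and meager: "U\<^sub>0 \<inter> (\<Inter>m. G m) = {}"
  obtains \<gamma> where "nested_families X U\<^sub>0 G \<gamma>"
proof -
  define good where "good \<U> \<longleftrightarrow> (\<forall>U\<in>\<U>. openin X U) \<and> pairwise disjnt \<U> \<and>
      (\<forall>V. openin X V \<and> V \<noteq> {} \<and> V \<subseteq> U\<^sub>0 \<longrightarrow> (\<exists>U\<in>\<U>. U \<inter> V \<noteq> {}))" for \<U>
  define refines where
    "refines m \<U> \<F> \<longleftrightarrow> (\<forall>W\<in>\<F>. \<exists>U\<in>\<U>. X closure_of W \<subseteq> U \<inter> G m)" for m \<U> \<F>
  have step: "\<exists>\<F>. good \<F> \<and> refines m \<U> \<F>" if "good \<U>" for \<U> m
  proof -
    have "\<And>U. U \<in> \<U> \<Longrightarrow> openin X U"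
      using that by (auto simp: good_def)
    then obtain \<F> where "\<And>W. W \<in> \<F> \<Longrightarrow> openin X W" "pairwise disjnt \<F>"
      "\<And>W. W \<in> \<F> \<Longrightarrow> \<exists>U\<in>\<U>. X closure_of W \<subseteq> U \<inter> G m"
      "\<And>V. openin X V \<Longrightarrow> \<exists>U\<in>\<U>. U \<inter> V \<noteq> {} \<Longrightarrow> \<exists>W\<in>\<F>. W \<inter> V \<noteq> {}"
      by (rule quasi_regular_open_disjoint_refinement[OF qr _ G(1)[of m] G(2)[of m]]) blast+
    then have "good \<F> \<and> refines m \<U> \<F>"
      using that unfolding good_def refines_def by simp
    then show ?thesis by blast
  qed
  have "good {U\<^sub>0}"
    using U\<^sub>0 by (auto simp: good_def)
  then obtain \<gamma> where \<gamma>: "\<gamma> 0 = {U\<^sub>0}" "\<And>m. good (\<gamma> m)" "\<And>m. refines m (\<gamma> m) (\<gamma> (Suc m))"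
    using dependent_nat_choice[of "\<lambda>m \<U>. good \<U> \<and> (m = 0 \<longrightarrow> \<U> = {U\<^sub>0})" refines] step
    by auto metis
  have "nested_families X U\<^sub>0 G \<gamma>"
  proof
    show "U = U'" if "U \<in> \<gamma> m" "U' \<in> \<gamma> m" "U \<inter> U' \<noteq> {}" for U U' m
      using \<gamma>(2)[of m] that unfolding good_def pairwise_def disjnt_def by metis
  qed (use \<gamma> meager in \<open>auto simp: good_def refines_def\<close>)
  then show thesis by (rule that)
qed

context nested_families
begin

lemma shrinks_subset:
  assumes "W \<in> \<gamma> (Suc m)"
  shows "\<exists>U\<in>\<gamma> m. W \<subseteq> U \<inter> G m"
  using shrinks[OF assms] closure_of_subset[OF openin_subset[OF open_member[OF assms]]]
  by blast

lemma ancestor: "W \<in> \<gamma> (m + k) \<Longrightarrow> \<exists>U\<in>\<gamma> m. W \<subseteq> U"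
proof (induction k arbitrary: W)
  case (Suc k)
  then obtain U where U: "U \<in> \<gamma> (m + k)" "W \<subseteq> U"
    using shrinks_subset[of W "m + k"] by auto
  then show ?case using Suc.IH[OF U(1)] by blast
qed auto

text \<open>A point outside \<open>G m\<close> belongs to no member of a level above \<open>m\<close>, and to at most one member of
  each of the remaining levels.\<close>

lemma finite_members_containing: "finite {U. \<exists>m. U \<in> \<gamma> m \<and> x \<in> U}"
proof (cases "x \<in> U\<^sub>0")
  case True
  then obtain M where M: "x \<notin> G M"
    using no_common_point by blast
  have "m \<le> M" if U: "U \<in> \<gamma> m" "x \<in> U" for U m
  proof (rule ccontr)
    assume "\<not> m \<le> M"
    then obtain j where "m = Suc M + j"
      using less_imp_Suc_add[of M m] by auto
    then obtain W where "W \<in> \<gamma> (Suc M)" "U \<subseteq> W"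
      using ancestor U by blast
    with shrinks_subset[of W M] U M show False by blast
  qed
  then have "{U. \<exists>m. U \<in> \<gamma> m \<and> x \<in> U} \<subseteq> (\<Union>m\<le>M. {U \<in> \<gamma> m. x \<in> U})"
    by blast
  moreover have "finite {U \<in> \<gamma> m. x \<in> U}" for m
  proof (cases "\<exists>U\<in>\<gamma> m. x \<in> U")
    case True
    then obtain U where "U \<in> \<gamma> m" "x \<in> U" by blast
    then have "{U \<in> \<gamma> m. x \<in> U} \<subseteq> {U}"
      using disjoint_members by blast
    then show ?thesis using finite_subset by blast
  next
    case False
    then have "{U \<in> \<gamma> m. x \<in> U} = {}" by blast
    then show ?thesis by (metis finite.emptyI)
  qed
  ultimately show ?thesis
    by (meson finite_UN_I finite_atMost finite_subset)
next
  case False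
  then have "{U. \<exists>m. U \<in> \<gamma> m \<and> x \<in> U} = {}"
    using ancestor[of _ 0] root by fastforce
  then show ?thesis by (metis finite.emptyI)
qed

text \<open>If \<open>x \<in> V\<close> is outside \<open>G m\<close>, then \<open>x\<close> is outside the closure of every member of level \<open>m + 1\<close>.
  So no single member of this level can be dense in \<open>V\<close>.\<close>

lemma splits:
  assumes V: "openin X V" "V \<noteq> {}" "V \<subseteq> U\<^sub>0"
  obtains m A B where "A \<in> \<gamma> m" "B \<in> \<gamma> m" "A \<inter> B = {}" "A \<inter> V \<noteq> {}" "B \<inter> V \<noteq> {}"
proof -
  obtain x m where x: "x \<in> V" "x \<notin> G m"
    using V no_common_point by blast
  obtain A where A: "A \<in> \<gamma> (Suc m)" "A \<inter> V \<noteq> {}"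
    using dense_union[OF V] by blast
  let ?V = "V - X closure_of A"
  have "x \<in> ?V"
    using shrinks[OF A(1)] x by blast
  moreover have "openin X ?V"
    using V(1) by (intro openin_diff) auto
  ultimately obtain B where B: "B \<in> \<gamma> (Suc m)" "B \<inter> ?V \<noteq> {}"
    using dense_union[of ?V "Suc m"] V(3) by blast
  have "A \<subseteq> X closure_of A"
    using closure_of_subset openin_subset open_member A(1) by metis
  then have "A \<noteq> B"
    using B by blast
  then show thesis
    using that A B disjoint_members by blast
qed


section \<open>Relations that respect the levels up to a lag\<close>

definition lag :: "nat \<Rightarrow> ('a \<times> 'a) set \<Rightarrow> bool" where
  "lag k R \<longleftrightarrow> (\<forall>m. \<forall>W\<in>\<gamma> (m + k). \<exists>U\<in>\<gamma> m. W \<subseteq> U \<and> R `` W \<subseteq> U)"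

lemma lag_relcomp: "lag k R \<Longrightarrow> lag l S \<Longrightarrow> lag (l + k) (R O S)"
  unfolding lag_def relcomp_Image add.assoc[symmetric] by (meson Image_mono order_refl subset_trans)

lemma lag_mono: "lag k R \<Longrightarrow> S \<subseteq> R \<Longrightarrow> lag k S"
  unfolding lag_def by (meson Image_mono order_refl subset_trans)

text \<open>The closure of \<open>R\<close> maps an open set \<open>W\<close> into the closure of \<open>R `` W\<close>, and passing to closures
  costs one level.\<close>

lemma lag_square_closure:
  assumes R: "lag k R"
  shows "lag (Suc k) (square_closure X R)"
  unfolding lag_def
proof (intro allI ballI)
  fix m W assume W: "W \<in> \<gamma> (m + Suc k)"
  then obtain A where A: "A \<in> \<gamma> (Suc m)" "W \<subseteq> A" "R `` W \<subseteq> A"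
    using R unfolding lag_def by (metis add_Suc_shift)
  then obtain U where U: "U \<in> \<gamma> m" "X closure_of A \<subseteq> U"
    using shrinks by blast
  have clA: "A \<subseteq> X closure_of A"
    using closure_of_subset openin_subset open_member A(1) by metis
  have "y \<in> X closure_of A" if "x \<in> W" "(x, y) \<in> square_closure X R" for x y
  proof (rule ccontr)
    assume y: "y \<notin> X closure_of A"
    let ?N = "W \<times> (topspace X - X closure_of A)"
    have "openin (prod_topology X X) ?N"
      using open_member[OF W] by (simp add: openin_prod_Times_iff openin_diff)
    moreover have "(x, y) \<in> ?N"
      using that y by (auto simp: square_closure_def in_closure_of)
    ultimately obtain p where "p \<in> R" "p \<in> ?N"
      using \<open>(x, y) \<in> square_closure X R\<close> unfolding square_closure_def in_closure_of by meson
    with A(3) clA show False by blast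
  qed
  then have "square_closure X R `` W \<subseteq> U"
    using U(2) by blast
  moreover have "W \<subseteq> U"
    using A(2) clA U(2) by blast
  ultimately show "\<exists>U\<in>\<gamma> m. W \<subseteq> U \<and> square_closure X R `` W \<subseteq> U"
    using U(1) by blast
qed

end

lemma vertical_closure_subset_square_closure:
  "vertical_closure X R \<subseteq> square_closure X R"
proof
  fix p assume "p \<in> vertical_closure X R"
  then obtain x y where p: "p = (x, y)" and x: "x \<in> topspace X"
    and y: "y \<in> X closure_of (R `` {x})"
    by (auto simp: vertical_closure_def)
  have "(x, y) \<in> (X closure_of {x}) \<times> (X closure_of (R `` {x}))"
    using x y closure_of_subset[of "{x}" X] by blast
  also have "\<dots> = prod_topology X X closure_of ({x} \<times> R `` {x})"
    by (simp add: closure_of_Times)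
  also have "\<dots> \<subseteq> prod_topology X X closure_of R"
    by (intro closure_of_mono) blast
  finally show "p \<in> square_closure X R"
    by (simp add: p square_closure_def)
qed

context nested_families
begin

definition member_nbhd :: "('a \<times> 'a) set" where
  "member_nbhd = {(x, y) \<in> topspace X \<times> topspace X. \<forall>m. \<forall>U\<in>\<gamma> m. x \<in> U \<longrightarrow> y \<in> U}"

lemma member_nbhd_semi_nbhds: "member_nbhd \<in> semi_nbhds X"
proof -
  have "x \<in> X interior_of (member_nbhd `` {x})" if x: "x \<in> topspace X" for x
  proof -
    let ?M = "insert (topspace X) {U. \<exists>m. U \<in> \<gamma> m \<and> x \<in> U}"
    have "member_nbhd `` {x} = \<Inter>?M"
      using x by (auto simp: member_nbhd_def)
    moreover have "openin X (\<Inter>?M)"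
      using finite_members_containing open_member by (intro openin_Inter) auto
    moreover have "x \<in> \<Inter>?M"
      using x by blast
    ultimately show ?thesis
      by (simp add: interior_of_openin)
  qed
  then show ?thesis
    by (auto simp: semi_nbhds_def member_nbhd_def)
qed

lemma lag_member_nbhd: "lag 0 member_nbhd"
  unfolding lag_def member_nbhd_def by auto

lemma lag_comp_seq: "lag 0 (comp_seq (\<lambda>_. member_nbhd) n)"
proof (induction "\<lambda>_::nat. member_nbhd" n rule: comp_seq.induct)
  case 1
  then show ?case by (auto simp: lag_def)
next
  case 2
  then show ?case by (simp add: lag_member_nbhd)
next
  case (3 m)
  then show ?case using lag_relcomp[OF _ lag_member_nbhd] by force
qed

lemma lag_closed_comp_seq: "lag n (closed_comp_seq X (\<lambda>_. member_nbhd) n)"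
proof (induction n)
  case 0
  then show ?case by (auto simp: lag_def)
next
  case (Suc n)
  show ?case
  proof (cases n)
    case 0
    then show ?thesis using lag_square_closure[OF lag_member_nbhd] by simp
  next
    case (Suc m)
    with Suc.IH show ?thesis
      using lag_square_closure[OF lag_relcomp[OF _ lag_member_nbhd]] by simp
  qed
qed

lemma lag_vertical_closure: "lag k R \<Longrightarrow> lag (Suc k) (vertical_closure X R)"
  using lag_square_closure lag_mono vertical_closure_subset_square_closure by blast

lemma family_contains_lag:
  assumes "\<P> \<in> {Delta_n_family n X, vDelta_family X, cDelta_family X,
                 cDelta_plus_family X, cDelta_n_family n X}"
  obtains R k where "R \<in> \<P>" "lag k R"
proof -
  let ?P = "member_nbhd"
  note P = member_nbhd_semi_nbhds
  have PP: "lag 0 (?P O ?P)"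
    using lag_relcomp[OF lag_member_nbhd lag_member_nbhd] by simp
  consider "\<P> = Delta_n_family n X" | "\<P> = vDelta_family X" | "\<P> = cDelta_family X"
    | "\<P> = cDelta_plus_family X" | "\<P> = cDelta_n_family n X"
    using assms by blast
  then show thesis
  proof cases
    case 1
    then have "comp_seq (\<lambda>_. ?P) n \<in> \<P>"
      using P unfolding Delta_n_family_def by blast
    then show thesis using that lag_comp_seq by blast
  next
    case 2
    then have "vertical_closure X ?P \<in> \<P>"
      using P unfolding vDelta_family_def by blast
    then show thesis using that lag_vertical_closure[OF lag_member_nbhd] by blast
  next
    case 3
    then have "square_closure X ?P \<in> \<P>"
      using P unfolding cDelta_family_def by blast
    then show thesis using that lag_square_closure[OF lag_member_nbhd] by blast
  next
    case 4
    then have "vertical_closure X (?P O ?P) \<in> \<P>"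
      using P unfolding cDelta_plus_family_def by blast
    then show thesis using that lag_vertical_closure[OF PP] by blast
  next
    case 5
    then have "closed_comp_seq X (\<lambda>_. ?P) n \<in> \<P>"
      using P unfolding cDelta_n_family_def by blast
    then show thesis using that lag_closed_comp_seq by blast
  qed
qed

lemma lag_misses_open_box:
  assumes R: "lag k R" and V: "openin X V" "V \<noteq> {}" "V \<subseteq> U\<^sub>0"
  obtains S T where "openin X S" "openin X T" "S \<noteq> {}" "T \<noteq> {}" "S \<subseteq> V" "T \<subseteq> V"
    "R \<inter> S \<times> T = {}"
proof -
  obtain m A B where AB: "A \<in> \<gamma> m" "B \<in> \<gamma> m" "A \<inter> B = {}" "A \<inter> V \<noteq> {}" "B \<inter> V \<noteq> {}"
    using splits[OF V] .
  have "openin X (A \<inter> V)"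
    using AB V open_member by blast
  then obtain W where W: "W \<in> \<gamma> (m + k)" "W \<inter> (A \<inter> V) \<noteq> {}"
    using dense_union[of "A \<inter> V" "m + k"] AB V by blast
  then obtain U where U: "U \<in> \<gamma> m" "W \<subseteq> U" "R `` W \<subseteq> U"
    using R unfolding lag_def by blast
  then have "U = A"
    using disjoint_members[OF U(1) AB(1)] W by blast
  then have "R \<inter> (W \<inter> V) \<times> (B \<inter> V) = {}"
    using U AB by blast
  moreover have "openin X (W \<inter> V)" "openin X (B \<inter> V)"
    using open_member W(1) AB(2) V(1) by blast+
  ultimately show thesis
    using that[of "W \<inter> V" "B \<inter> V"] W AB by blast
qed

end


section \<open>Normal square functors and meager open sets\<close>

lemma normal_square_functor_meets_open_box:
  assumes Q: "normal_square_functor \<Q>" and V: "openin X V"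
    and R: "square_restrict R V \<in> \<Q> (subtopology X V)"
    and S: "openin X S" "S \<noteq> {}" "S \<subseteq> V" and T: "openin X T" "T \<noteq> {}" "T \<subseteq> V"
  shows "R \<inter> S \<times> T \<noteq> {}"
proof -
  let ?Y = "subtopology X V"
  have "prod_topology ?Y ?Y closure_of (square_restrict R V) = topspace ?Y \<times> topspace ?Y"
    using Q R unfolding normal_square_functor_def by blast
  then have "prod_topology ?Y ?Y closure_of (square_restrict R V) = topspace (prod_topology ?Y ?Y)"
    by simp
  moreover have "openin (prod_topology ?Y ?Y) (S \<times> T)"
    using S T V by (simp add: openin_prod_Times_iff openin_open_subtopology)
  ultimately have "square_restrict R V \<inter> S \<times> T \<noteq> {}"
    using S(2) T(2) dense_intersects_open[of "prod_topology ?Y ?Y" "square_restrict R V"]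
    by simp
  then show ?thesis
    unfolding square_restrict_def by blast
qed

lemma meager_open_set_refutes_Delta:
  assumes qr: "quasi_regular_space X"
    and Q: "normal_square_functor \<Q>"
    and \<P>: "\<P> \<in> {Delta_n_family n X, vDelta_family X, cDelta_family X,
                 cDelta_plus_family X, cDelta_n_family n X}"
    and U: "openin X U"
    and \<G>: "countable \<G>" "\<And>G. G \<in> \<G> \<Longrightarrow> openin X G \<and> X closure_of G = topspace X"
    and meager: "U \<inter> \<Inter>\<G> = {}"
  shows "\<exists>R\<in>\<P>. \<forall>V. openin X V \<and> V \<noteq> {} \<and> V \<subseteq> U \<longrightarrow>
           square_restrict R V \<notin> \<Q> (subtopology X V)"
proof -
  \<comment> \<open>The whole space is added because an enumeration needs a nonempty family.\<close>
  define G where "G = from_nat_into (insert (topspace X) \<G>)"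
  have range_G: "range G = insert (topspace X) \<G>"
    unfolding G_def using \<G>(1) by (intro range_from_nat_into) auto
  have G: "openin X (G m) \<and> X closure_of (G m) = topspace X" for m
  proof -
    have "G m \<in> insert (topspace X) \<G>"
      using range_G by blast
    then show ?thesis using \<G>(2) by auto
  qed
  have "U \<inter> (\<Inter>m. G m) = {}"
    using meager by (simp add: range_G) blast
  with qr U G obtain \<gamma> where "nested_families X U G \<gamma>"
    using nested_families_exist by metis
  then interpret nested_families X U G \<gamma> .
  obtain R k where R: "R \<in> \<P>" "lag k R"
    using family_contains_lag[OF \<P>] .
  have "square_restrict R V \<notin> \<Q> (subtopology X V)"
    if V: "openin X V" "V \<noteq> {}" "V \<subseteq> U" for V
  proof -
    obtain S T where "openin X S" "openin X T" "S \<noteq> {}" "T \<noteq> {}" "S \<subseteq> V" "T \<subseteq> V"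
      "R \<inter> S \<times> T = {}"
      using lag_misses_open_box[OF R(2) V] .
    then show ?thesis
      using normal_square_functor_meets_open_box[OF Q V(1)] by blast
  qed
  with R(1) show ?thesis by blast
qed

theorem proposition4p27:
  fixes X :: "'a topology"
    and \<Q> :: "'a topology \<Rightarrow> ('a \<times> 'a) set set"
    and n :: nat
    and \<P> :: "('a \<times> 'a) set set"
  assumes "quasi_regular_space X"
    and "normal_square_functor \<Q>"
    and "\<P> \<in> {Delta_n_family n X, vDelta_family X, cDelta_family X,
               cDelta_plus_family X, cDelta_n_family n X}"
  shows "(Delta_nonmeager X \<P> \<Q> \<longrightarrow> nonmeager_space X) \<and>
         (Delta_Baire X \<P> \<Q> \<longrightarrow> Baire_space X)"
proof (intro conjI impI)
  assume \<Delta>: "Delta_nonmeager X \<P> \<Q>"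
  show "nonmeager_space X"
    unfolding nonmeager_space_def
  proof
    assume "\<exists>\<N>. countable \<N> \<and> (\<forall>N\<in>\<N>. nowhere_dense_in X N) \<and> topspace X = \<Union>\<N>"
    then obtain \<N> where \<N>: "countable \<N>" "\<And>N. N \<in> \<N> \<Longrightarrow> nowhere_dense_in X N"
      "topspace X = \<Union>\<N>"
      by metis
    let ?\<G> = "(\<lambda>N. topspace X - X closure_of N) ` \<N>"
    have "openin X G \<and> X closure_of G = topspace X" if "G \<in> ?\<G>" for G
      using that \<N>(2) by (auto simp: nowhere_dense_in_def closure_of_complement)
    moreover have "topspace X \<inter> \<Inter>?\<G> = {}"
    proof -
      have "x \<notin> \<Inter>?\<G>" if "x \<in> topspace X" for x
      proof -
        obtain N where N: "N \<in> \<N>" "x \<in> N"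
          using \<open>x \<in> topspace X\<close> unfolding \<N>(3) by blast
        then have "x \<in> X closure_of N"
          using \<N>(2)[of N] closure_of_subset[of N X] by (auto simp: nowhere_dense_in_def)
        with N(1) show ?thesis by auto
      qed
      then show ?thesis by (meson disjoint_iff)
    qed
    ultimately obtain R where "R \<in> \<P>"
      "\<forall>V. openin X V \<and> V \<noteq> {} \<and> V \<subseteq> topspace X \<longrightarrow>
         square_restrict R V \<notin> \<Q> (subtopology X V)"
      using meager_open_set_refutes_Delta[OF assms openin_topspace, of ?\<G>] \<N>(1) by blast
    with \<Delta> show False
      unfolding Delta_nonmeager_def using openin_subset by metis
  qed
next
  assume \<Delta>: "Delta_Baire X \<P> \<Q>"
  show "Baire_space X"
    unfolding Baire_space_def
  proof (intro allI impI)
    fix \<G> assume \<G>: "countable \<G> \<and> (\<forall>G\<in>\<G>. openin X G \<and> X closure_of G = topspace X)"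
    let ?D = "topspace X \<inter> \<Inter>\<G>"
    let ?U = "topspace X - X closure_of ?D"
    have "?U \<inter> \<Inter>\<G> = {}"
      using closure_of_subset[of ?D X] by blast
    moreover have "openin X ?U"
      by (intro openin_diff) auto
    ultimately obtain R where R: "R \<in> \<P>"
      "\<forall>V. openin X V \<and> V \<noteq> {} \<and> V \<subseteq> ?U \<longrightarrow> square_restrict R V \<notin> \<Q> (subtopology X V)"
      using meager_open_set_refutes_Delta[OF assms, of ?U \<G>] \<G> by blast
    have "?U = {}"
    proof (rule ccontr)
      assume "?U \<noteq> {}"
      with \<open>openin X ?U\<close> R \<Delta> show False
        unfolding Delta_Baire_def by blast
    qed
    then show "X closure_of ?D = topspace X"
      using closure_of_subset_topspace[of X ?D] by blast
  qed
qed

end
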